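(* Let $k\le n$ be positive integers, let $K$ be a field, and let $H_1,\dots,H_q$ be hyperplanes in $\mathbb{P}^k_K$ (not necessarily distinct) in $n$-subgeneral position. If $q>2n-k+1$, then there exist real numbers $\omega_1,\dots,\omega_q\in\mathbb{R}$ such that (i) $\omega_i\ge 0$ for all $i$; (ii) $\omega_i\le\tau$ for all $i$, where $$\tau=\frac{\sum_{i=1}^q\omega_i-k-1}{q-2n+k-1};$$ (iii) for every nonempty linear subspace $L\subseteq\mathbb{P}^k$, $$\sum_{\{i\,:\,H_i\supseteq L\}}\omega_i\le\operatorname{codim}L,$$ where $\operatorname{codim}L=k-\dim L$ is the codimension of $L$ in $\mathbb{P}^k$.
   Context: Hyperplanes $H_1,\dots,H_q$ in $\mathbb{P}^k$ (repetitions allowed) are said to be in $n$-subgeneral position if there exist an embedding of $\mathbb{P}^k$ as a linear subspace of $\mathbb{P}^n$ and distinct hyperplanes $H_1',\dots,H_q'$ of $\mathbb{P}^n$ in general position (any $m\le n+1$ of them intersect in a linear subspace of codimension exactly $m$ in $\mathbb{P}^n$) such that $H_i=H_i'\cap\mathbb{P}^k$ for all $i$. *)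

theory Defs
  imports "HOL-Analysis.Cartesian_Space"
begin

text \<open>
  The type \<open>'a ^ 'm\<close> with \<open>CARD('m) = m + 1\<close> is the vector space of homogeneous coordinates of the
  projective space of dimension \<open>m\<close> over the field \<open>'a\<close>. A point is a one-dimensional vector
  subspace, and a subset of the projective space is a set of such points.
\<close>

definition projectivization :: "('a::field ^ 'm) set \<Rightarrow> ('a ^ 'm) set set" where
  "projectivization V = {p. vec.subspace p \<and> vec.dim p = 1 \<and> p \<subseteq> V}"

abbreviation proj_space :: "('a::field ^ 'm) set set" where
  "proj_space \<equiv> projectivization UNIV"

definition proj_subspace :: "('a::field ^ 'm) set set \<Rightarrow> bool" where
  "proj_subspace L \<longleftrightarrow> (\<exists>V. vec.subspace V \<and> L = projectivization V)"

text \<open>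
  The set \<open>\<Union>L\<close> is the affine cone over \<open>L\<close>, and \<^const>\<open>vec.dim\<close> of a set is the dimension of its
  span. The empty subspace has dimension \<open>-1\<close>.
\<close>

definition proj_dim :: "('a::field ^ 'm) set set \<Rightarrow> int" where
  "proj_dim L = int (vec.dim (\<Union>L)) - 1"

definition proj_codim :: "('a::field ^ 'm) set set \<Rightarrow> int" where
  "proj_codim L = proj_dim (proj_space :: ('a ^ 'm) set set) - proj_dim L"

definition proj_hyperplane :: "('a::field ^ 'm) set set \<Rightarrow> bool" where
  "proj_hyperplane H \<longleftrightarrow> proj_subspace H \<and> proj_codim H = 1"

text \<open>
  Intersecting with \<^const>\<open>proj_space\<close> only matters for the empty subfamily. In dimension \<open>n\<close> one has
  \<open>CARD('n) = n + 1\<close>, and an intersection of codimension \<open>n + 1\<close> is empty.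
\<close>

definition general_position :: "nat \<Rightarrow> (nat \<Rightarrow> ('a::field ^ 'n) set set) \<Rightarrow> bool" where
  "general_position q H \<longleftrightarrow>
     (\<forall>I \<subseteq> {1..q}. card I \<le> CARD('n) \<longrightarrow>
        proj_subspace (proj_space \<inter> (\<Inter>i\<in>I. H i)) \<and>
        proj_codim (proj_space \<inter> (\<Inter>i\<in>I. H i)) = int (card I))"

text \<open>
  An embedding of one projective space as a linear subspace of another is the map on points
  \<open>p \<mapsto> f ` p\<close> induced by an injective linear map \<open>f\<close> of homogeneous coordinates. The type argument
  stands for the dimension \<open>n\<close> of the ambient space, through \<open>CARD('n) = n + 1\<close>.
\<close>

definition subgeneral_position ::
  "'n::finite itself \<Rightarrow> nat \<Rightarrow> (nat \<Rightarrow> ('a::field ^ 'k) set set) \<Rightarrow> bool" where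
  "subgeneral_position (N :: 'n itself) q H \<longleftrightarrow>
     (\<exists>(f :: 'a ^ 'k \<Rightarrow> 'a ^ 'n) (H' :: nat \<Rightarrow> ('a ^ 'n) set set).
        Vector_Spaces.linear (*s) (*s) f \<and> inj f \<and>
        (\<forall>i\<in>{1..q}. proj_hyperplane (H' i)) \<and>
        inj_on H' {1..q} \<and>
        general_position q H' \<and>
        (\<forall>i\<in>{1..q}. (\<lambda>p. f ` p) ` H i = H' i \<inter> (\<lambda>p. f ` p) ` proj_space))"

end

theory Submission
  imports Defs
begin

text \<open>
  Let \<open>r S\<close> be the codimension of the intersection of the hyperplanes indexed by \<open>S\<close>; it is monotone and
  submodular, and subgeneral position gives \<open>card S \<le> r S + (n - k)\<close> as soon as \<open>r S \<le> k\<close>.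
  In the plane, let \<open>\<tau>\<close> be the largest slope of a line from a point \<open>(card S, r S)\<close> with \<open>r S \<le> k\<close> to
  \<open>(2 * n - k + 1, k + 1)\<close>, attained at \<open>S = A\<close>. Maximality says that no point lies below the line of
  slope \<open>\<tau>\<close> through \<open>A\<close>, so the polymatroid of \<open>r\<close> on \<open>A\<close> truncated at \<open>\<tau>\<close> still has rank \<open>r A\<close>, and
  the greedy algorithm yields weights at most \<open>\<tau>\<close> on \<open>A\<close> of total \<open>r A\<close>. All other weights
  are \<open>\<tau>\<close>. Since \<open>A\<close> lies on the line, the formula for \<open>\<tau>\<close> holds. The bound on the weight of \<open>S\<close> follows
  from submodularity if \<open>r (S \<union> A) \<le> k\<close>; otherwise \<open>r S + r A \<ge> k + 1\<close>, and then already
  \<open>\<tau> * card S \<le> r S\<close>.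
\<close>

section \<open>Greedy vectors of submodular functions\<close>

text \<open>Elements enter one at a time, and each receives the increase of \<open>g\<close> that it
  causes. By submodularity this is at most the increase it causes over any smaller set, so the upper
  bounds survive each insertion.\<close>

lemma greedy_vector:
  fixes g :: "'a set \<Rightarrow> real"
  assumes "finite A" and "g {} = 0"
    and "\<And>S T. S \<subseteq> A \<Longrightarrow> T \<subseteq> A \<Longrightarrow> g (S \<union> T) + g (S \<inter> T) \<le> g S + g T"
  shows "\<exists>w. sum w A = g A \<and> (\<forall>S\<subseteq>A. sum w S \<le> g S)"
  using assms
proof (induction A rule: finite_induct)
  case empty
  then show ?case by auto
next
  case (insert x B)
  have "\<exists>w. sum w B = g B \<and> (\<forall>S\<subseteq>B. sum w S \<le> g S)"
    using insert.prems by (intro insert.IH) auto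
  then obtain w where w: "sum w B = g B" "\<And>S. S \<subseteq> B \<Longrightarrow> sum w S \<le> g S"
    by blast
  define w' where "w' = w(x := g (insert x B) - g B)"
  have agree: "sum w' S = sum w S" if "x \<notin> S" for S
    using that by (auto simp: w'_def intro!: sum.cong)
  have "sum w' (insert x B) = g (insert x B)"
    using insert.hyps agree[of B] w(1) by (simp add: w'_def)
  moreover have "sum w' S \<le> g S" if S: "S \<subseteq> insert x B" for S
  proof (cases "x \<in> S")
    case False
    then show ?thesis using S agree[of S] w(2)[of S] by auto
  next
    case True
    have "finite S" using S insert.hyps(1) finite_subset by blast
    then have "sum w' S = w' x + sum w' (S - {x})"
      using True by (simp add: sum.remove)
    also have "\<dots> = g (insert x B) - g B + sum w (S - {x})"
      using agree[of "S - {x}"] by (simp add: w'_def)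
    finally have sum: "sum w' S = g (insert x B) - g B + sum w (S - {x})" .
    have "S \<union> B = insert x B" "S \<inter> B = S - {x}"
      using True S insert.hyps(2) by auto
    then have "g (insert x B) + g (S - {x}) \<le> g S + g B"
      using insert.prems(2)[of S B] S by auto
    moreover have "sum w (S - {x}) \<le> g (S - {x})"
      using S by (intro w(2)) auto
    ultimately show ?thesis using sum by linarith
  qed
  ultimately show ?case by blast
qed

text \<open>The greedy vector is taken for a truncation \<open>g\<close> of \<open>r\<close>:
  monotonicity of \<open>g\<close> makes the weights nonnegative, \<open>g {i} \<le> t\<close> caps
  them, and \<open>bound\<close> says exactly that truncating does not lower the value at
  \<open>A\<close>.\<close>

lemma bounded_greedy_vector:
  fixes r :: "'a set \<Rightarrow> real" and t :: real
  assumes A: "finite A" and r0: "r {} = 0" and t: "t \<ge> 0"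
    and mono: "\<And>S T. S \<subseteq> T \<Longrightarrow> T \<subseteq> A \<Longrightarrow> r S \<le> r T"
    and submod: "\<And>S T. S \<subseteq> A \<Longrightarrow> T \<subseteq> A \<Longrightarrow> r (S \<union> T) + r (S \<inter> T) \<le> r S + r T"
    and bound: "\<And>S. S \<subseteq> A \<Longrightarrow> r A \<le> r S + t * card (A - S)"
  shows "\<exists>w. sum w A = r A \<and> (\<forall>S\<subseteq>A. sum w S \<le> r S) \<and> (\<forall>i\<in>A. 0 \<le> w i \<and> w i \<le> t)"
proof -
  define h where "h S T = r T + t * card (S - T)" for S T
  \<comment> \<open>the truncation of the polymatroid of \<open>r\<close> at \<open>t\<close>\<close>
  define g where "g S = Min (h S ` Pow S)" for S
  have g_le: "g S \<le> h S T" if "T \<subseteq> S" "S \<subseteq> A" for S T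
    unfolding g_def using that A by (intro Min_le) (auto intro: finite_subset)
  have g_attained: "\<exists>T\<subseteq>S. g S = h S T" if "S \<subseteq> A" for S
  proof -
    have "g S \<in> h S ` Pow S"
      unfolding g_def using that A by (intro Min_in) (auto intro: finite_subset)
    then show ?thesis by auto
  qed
  have g_mono: "g S \<le> g T" if ST: "S \<subseteq> T" "T \<subseteq> A" for S T
  proof -
    obtain U where U: "U \<subseteq> T" "g T = h T U" using g_attained ST by blast
    have "g S \<le> h S (S \<inter> U)" using ST by (intro g_le) auto
    also have "\<dots> \<le> h T U"
    proof -
      have "card (S - S \<inter> U) \<le> card (T - U)"
        using ST A by (intro card_mono) (auto intro: finite_subset)
      moreover have "r (S \<inter> U) \<le> r U" using U ST by (intro mono) auto
      ultimately show ?thesis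
        using t by (auto simp: h_def intro!: add_mono mult_left_mono)
    qed
    finally show ?thesis using U by simp
  qed
  have g_submod: "g (S \<union> T) + g (S \<inter> T) \<le> g S + g T" if ST: "S \<subseteq> A" "T \<subseteq> A" for S T
  proof -
    obtain U where U: "U \<subseteq> S" "g S = h S U" using g_attained ST by blast
    obtain V where V: "V \<subseteq> T" "g T = h T V" using g_attained ST by blast
    have fin: "finite S" "finite T" "finite U" "finite V"
      using ST U V A by (meson finite_subset)+
    have h: "h S' T' = r T' + t * (real (card S') - real (card T'))"
      if "T' \<subseteq> S'" "finite S'" for S' T'
      using that by (simp add: h_def card_Diff_subset finite_subset of_nat_diff card_mono)
    \<comment> \<open>The union and the intersection of the two minimizers compete in the minima for
      \<open>S \<union> T\<close> and \<open>S \<inter> T\<close>. The cardinality terms are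
      modular, so they cancel and only submodularity of \<open>r\<close> is left.\<close>
    have "g (S \<union> T) + g (S \<inter> T) \<le> h (S \<union> T) (U \<union> V) + h (S \<inter> T) (U \<inter> V)"
      using U V ST by (intro add_mono g_le) auto
    also have "\<dots> = r (U \<union> V) + r (U \<inter> V)
        + t * (real (card (S \<union> T) + card (S \<inter> T)) - real (card (U \<union> V) + card (U \<inter> V)))"
      using U V fin by (subst (1 2) h) (auto simp: algebra_simps)
    also have "\<dots> = r (U \<union> V) + r (U \<inter> V)
        + t * (real (card S + card T) - real (card U + card V))"
      using fin by (simp only: card_Un_Int)
    also have "\<dots> \<le> r U + r V + t * (real (card S + card T) - real (card U + card V))"
      using submod[of U V] U V ST by auto
    also have "\<dots> = g S + g T"
      using U V fin by (simp add: h algebra_simps)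
    finally show ?thesis .
  qed
  have g0: "g {} = 0" by (simp add: g_def h_def r0)
  have gA: "g A = r A"
  proof (rule antisym)
    show "g A \<le> r A" using g_le[of A A] by (simp add: h_def)
    obtain U where "U \<subseteq> A" "g A = h A U" using g_attained by blast
    then show "r A \<le> g A" using bound by (simp add: h_def)
  qed
  obtain w where w: "sum w A = g A" "\<And>S. S \<subseteq> A \<Longrightarrow> sum w S \<le> g S"
    using greedy_vector[of A g] A g0 g_submod by blast
  have "sum w S \<le> r S" if "S \<subseteq> A" for S
    using w(2)[OF that] g_le[of S S] that by (simp add: h_def)
  \<comment> \<open>The total is \<open>g A\<close>, while the elements other than \<open>i\<close>
    weigh at most \<open>g (A - {i}) \<le> g A\<close>.\<close>
  moreover have "0 \<le> w i" if "i \<in> A" for i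
    using w(1) w(2)[of "A - {i}"] g_mono[of "A - {i}" A] sum.remove[OF A that, of w] by auto
  moreover have "w i \<le> t" if "i \<in> A" for i
    using w(2)[of "{i}"] g_le[of "{}" "{i}"] that by (simp add: h_def r0)
  ultimately show ?thesis using w(1) gA by auto
qed

section \<open>Nochka weights for an abstract rank function\<close>

text \<open>The application has \<open>d = k + 1\<close> and \<open>m = n - k\<close>, so that
  \<open>d + 2 * m\<close> is \<open>2 * n - k + 1\<close>. One \<open>m\<close> absorbs the nullity
  bound; the other makes the maximal slope small enough for sets that span together with
  \<open>A\<close>.\<close>

lemma nochka_weights:
  fixes r :: "'a set \<Rightarrow> real" and d m :: real
  assumes E: "finite E" and r0: "r {} = 0" and d: "d > 0" and m: "m \<ge> 0"
    and mono: "\<And>S T. S \<subseteq> T \<Longrightarrow> T \<subseteq> E \<Longrightarrow> r S \<le> r T"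
    and submod: "\<And>S T. S \<subseteq> E \<Longrightarrow> T \<subseteq> E \<Longrightarrow> r (S \<union> T) + r (S \<inter> T) \<le> r S + r T"
    and le_d: "\<And>S. S \<subseteq> E \<Longrightarrow> r S \<le> d"
    and nullity: "\<And>S. S \<subseteq> E \<Longrightarrow> r S < d \<Longrightarrow> real (card S) \<le> r S + m"
  shows "\<exists>w t. (\<forall>i\<in>E. 0 \<le> w i \<and> w i \<le> t) \<and> sum w E = d + t * (card E - (d + 2 * m)) \<and>
    (\<forall>S\<subseteq>E. r S < d \<longrightarrow> sum w S \<le> r S)"
proof -
  define c where "c = d + 2 * m"
  define F where "F = {S. S \<subseteq> E \<and> r S < d}"
  define slope where "slope S = (d - r S) / (c - card S)" for S
  have F: "finite F" "F \<noteq> {}"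
    using E r0 d by (auto simp: F_def)
  define A where "A = arg_min_on (\<lambda>S. - slope S) F"
  have A: "A \<in> F" unfolding A_def using F by (rule arg_min_if_finite(1))
  have A_max: "slope S \<le> slope A" if "S \<in> F" for S
    using arg_min_least[OF F that, of "\<lambda>S. - slope S"] by (simp add: A_def)
  define t where "t = slope A"
  have AE: "A \<subseteq> E" and rA: "r A < d" using A by (auto simp: F_def)
  have finA: "finite A" using AE E finite_subset by blast
  \<comment> \<open>The surplus \<open>m\<close> on the right is the second \<open>m\<close> in
    \<open>c\<close>; it is what later bounds \<open>t\<close> away from 1 when
    \<open>m > 0\<close>.\<close>
  have den: "c - card S \<ge> d - r S + m" if "S \<in> F" for S
    using nullity[of S] that by (auto simp: F_def c_def)
  have den_pos: "c - card S > 0" if "S \<in> F" for S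
    using den[OF that] that m by (auto simp: F_def)
  have t_pos: "t > 0"
    using den_pos[OF A] rA by (simp add: t_def slope_def)
  have t_ge: "d - r S \<le> t * (c - card S)" if "S \<in> F" for S
  proof -
    have "slope S \<le> t" unfolding t_def using that by (rule A_max)
    then show ?thesis using den_pos[OF that] by (simp add: slope_def pos_divide_le_eq)
  qed
  have t_A: "t * (c - card A) = d - r A"
    using den_pos[OF A] by (simp add: t_def slope_def)
  have t_diff: "t * (real (card S) - real (card A)) \<le> r S - r A" if S: "S \<in> F" for S
    using t_ge[OF S] t_A by (simp add: algebra_simps)
  have "\<exists>w. sum w A = r A \<and> (\<forall>S\<subseteq>A. sum w S \<le> r S) \<and> (\<forall>i\<in>A. 0 \<le> w i \<and> w i \<le> t)"
  proof (rule bounded_greedy_vector)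
    fix S assume S: "S \<subseteq> A"
    then have "S \<in> F" using mono[of S A] AE rA by (auto simp: F_def)
    then show "r A \<le> r S + t * card (A - S)"
      using t_diff[of S] S finA
      by (simp add: card_Diff_subset finite_subset of_nat_diff card_mono algebra_simps)
  qed (use finA r0 t_pos mono submod AE in auto)
  then obtain v where v: "sum v A = r A" "\<And>S. S \<subseteq> A \<Longrightarrow> sum v S \<le> r S"
    "\<And>i. i \<in> A \<Longrightarrow> 0 \<le> v i \<and> v i \<le> t" by blast
  define w where "w i = (if i \<in> A then v i else t)" for i
  have w_sum: "sum w S = sum v (S \<inter> A) + t * card (S - A)" if "finite S" for S
  proof -
    have "sum w S = sum w (S \<inter> A) + sum w (S - A)"
      using that by (metis sum.Int_Diff)
    also have "sum w (S \<inter> A) = sum v (S \<inter> A)"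
      by (intro sum.cong) (auto simp: w_def)
    also have "sum w (S - A) = t * card (S - A)"
      by (simp add: w_def)
    finally show ?thesis .
  qed
  have w_bounds: "0 \<le> w i" "w i \<le> t" for i
    using v(3) t_pos by (auto simp: w_def)
  have "sum w E = r A + t * (real (card E) - real (card A))"
    using w_sum[OF E] AE v(1) finA E
    by (simp add: Int_absorb1 card_Diff_subset of_nat_diff card_mono)
  then have total: "sum w E = d + t * (card E - c)"
    using t_A by (simp add: algebra_simps)
  have "sum w S \<le> r S" if S: "S \<in> F" for S
  proof -
    have SE: "S \<subseteq> E" and rS: "r S < d" using S by (auto simp: F_def)
    have finS: "finite S" using SE E finite_subset by blast
    have sub: "r (S \<union> A) + r (S \<inter> A) \<le> r S + r A"
      using submod SE AE by blast
    show ?thesis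
    proof (cases "r (S \<union> A) < d")
      case True
      \<comment> \<open>The part of \<open>S\<close> outside \<open>A\<close> is paid for by the
        rank increase from \<open>A\<close> to \<open>S \<union> A\<close>, the part inside by
        \<open>r (S \<inter> A)\<close>; submodularity adds the two up to at most
        \<open>r S\<close>.\<close>
      then have "S \<union> A \<in> F" using SE AE by (auto simp: F_def)
      moreover have "card (S \<union> A) = card (S - A) + card A"
        using finS finA card_Un_disjoint[of "S - A" A] by (auto simp: Un_Diff_cancel2)
      ultimately have "t * card (S - A) \<le> r (S \<union> A) - r A"
        using t_diff[of "S \<union> A"] by simp
      moreover have "sum v (S \<inter> A) \<le> r (S \<inter> A)" by (intro v(2)) auto
      ultimately show ?thesis using sub w_sum[OF finS] by linarith
    next
      case False
      then have "r (S \<union> A) = d" using le_d[of "S \<union> A"] SE AE by auto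
      moreover have "0 \<le> r (S \<inter> A)" using mono[of "{}" "S \<inter> A"] SE r0 by auto
      ultimately have ge: "d - r A \<le> r S" using sub by linarith
      \<comment> \<open>Put \<open>x = d - r A\<close>. Then \<open>t \<le> x / (x + m)\<close>,
        which is nondecreasing in \<open>x\<close>, and \<open>r S \<ge> x\<close> gives
        \<open>t \<le> r S / (r S + m)\<close>. Since \<open>card S \<le> r S + m\<close>, weight
        \<open>t\<close> on every element of \<open>S\<close> is affordable. The computation below
        clears the denominators.\<close>
      have "t * (d - r A + m) \<le> t * (c - card A)"
        using den[OF A] t_pos by (intro mult_left_mono) auto
      then have t_ub: "t * (d - r A + m) \<le> d - r A" using t_A by simp
      have "sum w S \<le> card S * t"
        using w_bounds by (intro sum_bounded_above)
      also have "\<dots> \<le> (r S + m) * t"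
        using nullity[OF SE rS] t_pos by (intro mult_right_mono) auto
      also have "\<dots> \<le> r S"
      proof -
        have pos: "d - r A + m > 0" using rA m by linarith
        have "(r S + m) * (t * (d - r A + m)) \<le> (r S + m) * (d - r A)"
          using t_ub ge rA m by (intro mult_left_mono) auto
        also have "\<dots> \<le> r S * (d - r A + m)"
          using mult_right_mono[OF ge m] by (simp add: algebra_simps)
        finally have "((r S + m) * t) * (d - r A + m) \<le> r S * (d - r A + m)"
          by (simp add: mult.assoc)
        then show ?thesis using pos by simp
      qed
      finally show ?thesis .
    qed
  qed
  then show ?thesis
    using w_bounds total by (intro exI[of _ w] exI[of _ t]) (auto simp: F_def c_def)
qed

section \<open>Projective subspaces and their affine cones\<close>

lemma span_point:
  fixes v :: "'a::field ^ 'm::finite"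
  assumes "v \<noteq> 0"
  shows "vec.span {v} \<in> projectivization V \<longleftrightarrow> vec.span {v} \<subseteq> V"
proof -
  have "vec.dim (vec.span {v}) = 1"
    using assms by (simp add: vec.dim_span vec.dim_singleton)
  then show ?thesis by (simp add: projectivization_def)
qed

lemma span_singleton_subset:
  assumes "vec.subspace V"
  shows "vec.span {v} \<subseteq> V \<longleftrightarrow> v \<in> V"
  using assms vec.span_minimal[of "{v}" V] vec.span_base[of v "{v}"] by auto

text \<open>The \<open>insert 0\<close> matters only for \<open>V = {0}\<close>, which contains no
  projective point and so has an empty union. Dimension does not see the difference.\<close>

lemma Union_projectivization:
  fixes V :: "('a::field ^ 'm::finite) set"
  assumes "vec.subspace V"
  shows "insert 0 (\<Union>(projectivization V)) = V"
proof
  show "insert 0 (\<Union>(projectivization V)) \<subseteq> V"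
    using vec.subspace_0[OF assms] by (auto simp: projectivization_def)
  show "V \<subseteq> insert 0 (\<Union>(projectivization V))"
  proof
    fix v assume "v \<in> V"
    then show "v \<in> insert 0 (\<Union>(projectivization V))"
      using span_point[of v V] span_singleton_subset[OF assms, of v] vec.span_base[of v "{v}"]
      by (cases "v = 0") auto
  qed
qed

lemma dim_insert_0: "vec.dim (insert 0 S) = vec.dim (S :: ('a::field ^ 'm::finite) set)"
  by (metis vec.dim_span vec.span_insert_0)

lemma dim_Union_projectivization:
  fixes V :: "('a::field ^ 'm::finite) set"
  assumes "vec.subspace V"
  shows "vec.dim (\<Union>(projectivization V)) = vec.dim V"
  by (metis Union_projectivization[OF assms] dim_insert_0)

lemma proj_codim_eq:
  "proj_codim (L :: ('a::field ^ 'm::finite) set set) = int CARD('m) - int (vec.dim (\<Union>L))"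
  by (simp add: proj_codim_def proj_dim_def dim_Union_projectivization vec.subspace_UNIV
      vec.dim_UNIV card_cart_basis)

lemma projectivization_mono_iff:
  fixes U V :: "('a::field ^ 'm::finite) set"
  assumes "vec.subspace U" "vec.subspace V"
  shows "projectivization U \<subseteq> projectivization V \<longleftrightarrow> U \<subseteq> V"
proof
  show "U \<subseteq> V" if "projectivization U \<subseteq> projectivization V"
    using that Union_projectivization[OF assms(1)] Union_projectivization[OF assms(2)]
    by (metis Union_mono insert_mono)
qed (auto simp: projectivization_def)

text \<open>The injective map \<open>f\<close> carries the intersection of the \<open>V i\<close>
  into the cone over the intersection of the \<open>H' i\<close>, whose dimension general position
  prescribes.\<close>

lemma dim_INT_le_general_position:
  fixes f :: "'a::field ^ 'k::finite \<Rightarrow> 'a ^ 'n::finite"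
  assumes f: "Vector_Spaces.linear (*s) (*s) f" "inj f"
    and gp: "general_position q H'"
    and V: "\<And>i. i \<in> {1..q} \<Longrightarrow> (\<lambda>p. f ` p) ` projectivization (V i) \<subseteq> H' i"
      "\<And>i. i \<in> {1..q} \<Longrightarrow> vec.subspace (V i)"
    and I: "I \<subseteq> {1..q}" "card I \<le> CARD('n)"
  shows "vec.dim (\<Inter>i\<in>I. V i) + card I \<le> CARD('n)"
proof -
  interpret lf: Vector_Spaces.linear "(*s)" "(*s)" f by fact
  let ?L = "proj_space \<inter> (\<Inter>i\<in>I. H' i)"
  have "f v \<in> insert 0 (\<Union>?L)" if v: "v \<in> (\<Inter>i\<in>I. V i)" for v
  proof (cases "v = 0")
    case True
    then show ?thesis by (simp add: lf.zero)
  next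
    case False
    then have "f v \<noteq> 0" using f(2) lf.zero by (metis injD)
    moreover have span: "f ` vec.span {v} = vec.span {f v}"
      using lf.span_image[of "{v}"] by simp
    ultimately have "f ` vec.span {v} \<in> proj_space"
      by (simp add: span_point)
    moreover have "f ` vec.span {v} \<in> H' i" if "i \<in> I" for i
    proof -
      have "vec.span {v} \<in> projectivization (V i)"
        using that v I V(2)[of i] span_singleton_subset[of "V i" v] span_point[OF False] by blast
      then show ?thesis using V(1)[of i] that I by blast
    qed
    ultimately have "f ` vec.span {v} \<in> ?L" by blast
    moreover have "f v \<in> f ` vec.span {v}" by (simp add: vec.span_base)
    ultimately show ?thesis by blast
  qed
  then have "vec.dim (f ` (\<Inter>i\<in>I. V i)) \<le> vec.dim (insert 0 (\<Union>?L))"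
    by (intro vec.dim_subset) blast
  moreover have "vec.dim (f ` (\<Inter>i\<in>I. V i)) = vec.dim (\<Inter>i\<in>I. V i)"
    using f(2) by (intro vec.dim_image_eq[OF f(1)]) (auto intro: inj_on_subset)
  moreover have "proj_codim ?L = int (card I)"
    using gp I by (simp add: general_position_def)
  ultimately show ?thesis by (simp add: dim_insert_0 proj_codim_eq)
qed

text \<open>The sum of \<open>S\<close> and \<open>T\<close> still lies in \<open>U\<close>. With
  cones of intersections of hyperplanes in place of \<open>S\<close>, \<open>T\<close> and
  \<open>U\<close>, this becomes submodularity of codimension.\<close>

lemma dim_Int_ge:
  fixes S T :: "('a::field ^ 'm::finite) set"
  assumes "vec.subspace S" "vec.subspace T" "vec.subspace U" "S \<subseteq> U" "T \<subseteq> U"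
  shows "vec.dim S + vec.dim T \<le> vec.dim (S \<inter> T) + vec.dim U"
proof -
  have "{x + y |x y. x \<in> S \<and> y \<in> T} \<subseteq> U"
    using vec.subspace_add[OF assms(3)] assms(4,5) by auto
  then show ?thesis
    using vec.dim_sums_Int[OF assms(1,2)] vec.dim_subset[of "{x + y |x y. x \<in> S \<and> y \<in> T}" U]
    by linarith
qed

section \<open>Weights for hyperplanes in subgeneral position\<close>

theorem theorem1p1:
  fixes k n q :: nat
    and H :: "nat \<Rightarrow> ('K::field ^ 'k::finite) set set"
  assumes "0 < k" and "k \<le> n"
    and "CARD('k) = k + 1" and "CARD('n::finite) = n + 1"
    and "\<forall>i\<in>{1..q}. proj_hyperplane (H i)"
    and "subgeneral_position TYPE('n) q H"
    and "int q > 2 * int n - int k + 1"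
  shows "\<exists>(\<omega> :: nat \<Rightarrow> real) (\<tau> :: real).
    \<tau> = ((\<Sum>i=1..q. \<omega> i) - real k - 1) / (real q - 2 * real n + real k - 1) \<and>
    (\<forall>i\<in>{1..q}. 0 \<le> \<omega> i) \<and>
    (\<forall>i\<in>{1..q}. \<omega> i \<le> \<tau>) \<and>
    (\<forall>L. proj_subspace L \<and> L \<noteq> {} \<longrightarrow>
       (\<Sum>i | i \<in> {1..q} \<and> L \<subseteq> H i. \<omega> i) \<le> real_of_int (proj_codim L))"
proof -
  have "\<forall>i\<in>{1..q}. \<exists>V. vec.subspace V \<and> H i = projectivization V"
    using assms(5) unfolding proj_hyperplane_def proj_subspace_def by blast
  then obtain V where "\<forall>i\<in>{1..q}. vec.subspace (V i) \<and> H i = projectivization (V i)"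
    by (rule bchoice[THEN exE])
  then have V: "vec.subspace (V i)" and HV: "H i = projectivization (V i)" if "i \<in> {1..q}" for i
    using that by auto
  obtain f :: "'K ^ 'k \<Rightarrow> 'K ^ 'n" and H' where f: "Vector_Spaces.linear (*s) (*s) f" "inj f"
    and gp: "general_position q H'"
    and HH': "\<forall>i\<in>{1..q}. (\<lambda>p. f ` p) ` H i = H' i \<inter> (\<lambda>p. f ` p) ` proj_space"
    using assms(6) unfolding subgeneral_position_def by (elim exE conjE)
  define W where "W I = (\<Inter>i\<in>I. V i)" for I
  \<comment> \<open>Working with index sets counts repeated hyperplanes separately. The value
    \<open>k + 1\<close> means that the cone is zero, that is, the projective intersection is
    empty.\<close>
  define r where "r I = real k + 1 - vec.dim (W I)" for I
  have W_subspace: "vec.subspace (W I)" if "I \<subseteq> {1..q}" for I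
    unfolding W_def using that by (intro vec.subspace_Inter) (auto intro!: V)
  have dim_W: "vec.dim (W I) + card I \<le> n + 1" if "I \<subseteq> {1..q}" "card I \<le> n + 1" for I
  proof -
    have "(\<lambda>p. f ` p) ` projectivization (V i) \<subseteq> H' i" if "i \<in> {1..q}" for i
      using bspec[OF HH' that] HV[OF that] by (metis inf_le1)
    then show ?thesis
      using dim_INT_le_general_position[OF f gp _ V that(1)] that(2) assms(4) by (simp add: W_def)
  qed
  have "\<exists>w t. (\<forall>i\<in>{1..q}. 0 \<le> w i \<and> w i \<le> t) \<and>
      sum w {1..q} = (real k + 1) + t * (card {1..q} - ((real k + 1) + 2 * real (n - k))) \<and>
      (\<forall>S\<subseteq>{1..q}. r S < real k + 1 \<longrightarrow> sum w S \<le> r S)"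
  proof (rule nochka_weights)
    show "r {} = 0"
      using assms(3) by (simp add: r_def W_def vec.dim_UNIV card_cart_basis)
    show "r S \<le> r T" if "S \<subseteq> T" for S T
      using that by (auto simp: r_def W_def intro!: vec.dim_subset)
    show "r (S \<union> T) + r (S \<inter> T) \<le> r S + r T" if "S \<subseteq> {1..q}" "T \<subseteq> {1..q}" for S T
    proof -
      have "W (S \<union> T) = W S \<inter> W T" by (auto simp: W_def)
      moreover have "vec.dim (W S) + vec.dim (W T) \<le> vec.dim (W S \<inter> W T) + vec.dim (W (S \<inter> T))"
        using that by (intro dim_Int_ge W_subspace) (auto simp: W_def)
      ultimately show ?thesis by (simp add: r_def)
    qed
    show "real (card S) \<le> r S + real (n - k)" if S: "S \<subseteq> {1..q}" "r S < real k + 1" for S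
    proof -
      \<comment> \<open>\<open>dim_W\<close> covers at most \<open>n + 1\<close> indices, but that
        many already meet only in 0, which would force \<open>r S = k + 1\<close>.\<close>
      have "card S \<le> n + 1"
      proof (rule ccontr)
        assume "\<not> card S \<le> n + 1"
        then obtain T where T: "T \<subseteq> S" "card T = n + 1"
          by (metis nat_le_linear obtain_subset_with_card_n)
        then have "vec.dim (W T) = 0" using dim_W[of T] S by auto
        moreover have "vec.dim (W S) \<le> vec.dim (W T)"
          using T by (auto simp: W_def intro!: vec.dim_subset)
        ultimately show False using S by (simp add: r_def del: vec.dim_eq_0)
      qed
      then show ?thesis using dim_W[OF S(1)] assms(2) by (simp add: r_def of_nat_diff)
    qed
  qed (auto simp: r_def)
  then obtain w t where w: "\<forall>i\<in>{1..q}. 0 \<le> w i \<and> w i \<le> t"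
    and total: "sum w {1..q} = (real k + 1) + t * (card {1..q} - ((real k + 1) + 2 * real (n - k)))"
    and le_r: "\<forall>S\<subseteq>{1..q}. r S < real k + 1 \<longrightarrow> sum w S \<le> r S"
    by (elim exE conjE)
  \<comment> \<open>As \<open>(k + 1) + 2 * (n - k) = 2 * n - k + 1\<close>, this denominator is the
    coefficient of \<open>t\<close> in \<open>total\<close>, which can therefore be solved for
    \<open>t\<close>.\<close>
  have "real q - 2 * real n + real k - 1 > 0"
    using assms(7) by linarith
  then have "t = (sum w {1..q} - real k - 1) / (real q - 2 * real n + real k - 1)"
    using total assms(2) by (simp add: field_simps of_nat_diff)
  moreover have "(\<Sum>i | i \<in> {1..q} \<and> L \<subseteq> H i. w i) \<le> real_of_int (proj_codim L)"
    if L: "proj_subspace L" "L \<noteq> {}" for L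
  proof -
    obtain M where M: "vec.subspace M" and LM: "L = projectivization M"
      using L(1) by (auto simp: proj_subspace_def)
    define S where "S = {i. i \<in> {1..q} \<and> L \<subseteq> H i}"
    have "M \<subseteq> V i" if "i \<in> S" for i
      using that HV[of i] projectivization_mono_iff[OF M V[of i]]
      by (simp add: S_def LM)
    then have "vec.dim M \<le> vec.dim (W S)"
      unfolding W_def by (intro vec.dim_subset) blast
    \<comment> \<open>Nonemptiness of \<open>L\<close> enters here: it keeps \<open>r S\<close>
      below \<open>k + 1\<close>, the range in which \<open>le_r\<close> bounds the weight.\<close>
    moreover have "vec.dim M \<ge> 1"
    proof -
      obtain p where "vec.dim p = 1" "p \<subseteq> M"
        using L(2) unfolding LM projectivization_def by blast
      then show ?thesis using vec.dim_subset[of p M] by simp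
    qed
    ultimately have rS: "r S < real k + 1" "r S \<le> real_of_int (proj_codim L)"
      using assms(3) M by (simp_all add: r_def proj_codim_eq LM dim_Union_projectivization del: vec.dim_eq_0)
    have "S \<subseteq> {1..q}" by (auto simp: S_def)
    then have "sum w S \<le> r S" using le_r rS(1) by blast
    also note rS(2)
    finally have "sum w S \<le> real_of_int (proj_codim L)" .
    then show ?thesis by (simp add: S_def)
  qed
  ultimately show ?thesis using w by (intro exI[of _ w] exI[of _ t] conjI ballI allI impI) blast+
qed

end
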